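(* Let $\mu$ be a probability measure on the unit circle $\mathbb{T}$ with infinite support, and let $(x_n)_{n\ge 0}$ be its sequence of orthonormal Laurent polynomials (obtained from $1,z^{-1},z,z^{-2},z^2,\dots$). Then there exist a linear differential operator $D\colon \mathbb{C}[z,z^{-1}]\to\mathbb{C}[z,z^{-1}]$ of some (arbitrary) order $r\ge 1$ and an index $n_0\ge 1$ such that $$D x_n\in\operatorname{span}\{x_{n-1},x_n,x_{n+1}\}\qquad\text{for all } n\ge n_0$$ if and only if $\mu$ is the (normalized) Lebesgue measure on $\mathbb{T}$.
   Context: $\mathbb{T}=\{z\in\mathbb{C}:|z|=1\}$, and $\mathbb{C}[z,z^{-1}]$ is the space of complex Laurent polynomials. For a probability measure $\mu$ on $\mathbb{T}$ with infinite support, $(x_n)_{n\ge0}$ denotes the sequence of orthonormal Laurent polynomials (OLP) produced by Gram–Schmidt orthonormalization (with positive leading coefficients) in $L^2_\mu$ of the ordered sequence $1,z^{-1},z,z^{-2},z^2,\dots$. For the normalized Lebesgue (arc length) measure, $x_{2m-1}(z)=z^{-m}$ and $x_{2m}(z)=z^m$. A linear differential operator $D\colon\mathbb{C}[z,z^{-1}]\to\mathbb{C}[z,z^{-1}]$ of order $r\ge1$ is $D=\sum_{k=0}^r D_k(z)\frac{d^k}{dz^k}$ with $D_k\in\mathbb{C}[z,z^{-1}]$ and $D_r\neq0$. *)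

theory Defs
  imports "HOL-Probability.Probability" "HOL-Library.Poly_Mapping"
begin

text \<open>
  Complex Laurent polynomials are the finitely supported maps from exponents to coefficients; the
  multiplication that \<^theory>\<open>HOL-Library.Poly_Mapping\<close> puts on this type is convolution.
\<close>

type_synonym laurent = "int \<Rightarrow>\<^sub>0 complex"

definition laurent_scale :: "complex \<Rightarrow> laurent \<Rightarrow> laurent" where
  "laurent_scale c p = Poly_Mapping.single 0 c * p"

global_interpretation laurent: vector_space laurent_scale
proof
  fix a b :: complex and p q :: laurent
  show "laurent_scale a (p + q) = laurent_scale a p + laurent_scale a q"
    by (simp add: laurent_scale_def distrib_left)
  show "laurent_scale (a + b) p = laurent_scale a p + laurent_scale b p"
    by (simp add: laurent_scale_def single_add distrib_right)
  show "laurent_scale a (laurent_scale b p) = laurent_scale (a * b) p"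
    by (simp add: laurent_scale_def mult_single flip: mult.assoc)
  show "laurent_scale 1 p = p"
    by (simp add: laurent_scale_def)
qed

definition laurent_eval :: "laurent \<Rightarrow> complex \<Rightarrow> complex" where
  "laurent_eval p z = (\<Sum>j\<in>Poly_Mapping.keys p. Poly_Mapping.lookup p j * z powi j)"

definition laurent_deriv :: "laurent \<Rightarrow> laurent" where
  "laurent_deriv p =
     (\<Sum>j\<in>Poly_Mapping.keys p. Poly_Mapping.single (j - 1) (of_int j * Poly_Mapping.lookup p j))"

definition linear_diff_operator :: "nat \<Rightarrow> (laurent \<Rightarrow> laurent) \<Rightarrow> bool" where
  "linear_diff_operator r D \<longleftrightarrow>
     (\<exists>c :: nat \<Rightarrow> laurent. c r \<noteq> 0 \<and> (\<forall>p. D p = (\<Sum>k\<le>r. c k * (laurent_deriv ^^ k) p)))"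

definition circle_borel :: "complex measure" where
  "circle_borel = restrict_space borel (sphere 0 1)"

definition circle_lebesgue :: "complex measure" where
  "circle_lebesgue = distr (uniform_measure lborel {0..<2 * pi}) circle_borel cis"

definition measure_support :: "'a::topological_space measure \<Rightarrow> 'a set" where
  "measure_support M =
     {x \<in> space M. \<forall>U. open U \<and> x \<in> U \<longrightarrow> emeasure M (U \<inter> space M) > 0}"

definition laurent_inner :: "complex measure \<Rightarrow> laurent \<Rightarrow> laurent \<Rightarrow> complex" where
  "laurent_inner \<mu> p q = (LINT z|\<mu>. laurent_eval p z * cnj (laurent_eval q z))"

definition laurent_norm :: "complex measure \<Rightarrow> laurent \<Rightarrow> real" where
  "laurent_norm \<mu> p = sqrt (LINT z|\<mu>. (cmod (laurent_eval p z))\<^sup>2)"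

text \<open>The ordered sequence \<open>1, z\<^sup>-\<^sup>1, z, z\<^sup>-\<^sup>2, z\<^sup>2, \<dots>\<close>, indexed from \<open>0\<close>.\<close>

definition laurent_basis :: "nat \<Rightarrow> laurent" where
  "laurent_basis n =
     Poly_Mapping.single (if even n then int (n div 2) else - int (Suc n div 2)) 1"

text \<open>
  Gram--Schmidt in \<open>L\<^sup>2\<^sub>\<mu>\<close>. Dividing by the positive norm, without a further phase, is what makes
  the coefficient of \<open>laurent_basis n\<close> in \<open>olp \<mu> n\<close> positive when \<open>\<mu>\<close> has infinite support.
\<close>

fun olp :: "complex measure \<Rightarrow> nat \<Rightarrow> laurent" where
  "olp \<mu> n =
     (let y = laurent_basis n -
                (\<Sum>k<n. laurent_scale (laurent_inner \<mu> (laurent_basis n) (olp \<mu> k)) (olp \<mu> k))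
      in laurent_scale (complex_of_real (1 / laurent_norm \<mu> y)) y)"

declare olp.simps [simp del]

end

theory Submission
  imports Defs
begin

text \<open>
  If \<open>\<mu>\<close> is Lebesgue measure, the orthonormal Laurent polynomials are the monomials, and
  \<open>z d/dz\<close> multiplies each of them by its exponent. The content is the converse, which rests on
  applying one rigidity principle to \<open>D\<close> and then to its adjoint in \<open>L\<^sup>2\<^sub>\<mu>\<close>.

  Write \<open>D z\<^sup>m = \<Sum>\<^sub>s p\<^sub>s(m) z\<^bsup>m+s\<^esup>\<close>. For a differential operator every symbol \<open>p\<^sub>s\<close> is a polynomial
  in \<open>m\<close>. Let \<open>L\<^sub>n\<close> be the span of the first \<open>n + 1\<close> monomials in the order \<open>1, z\<^sup>-\<^sup>1, z, \<dots>\<close>. An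
  operator that acts tridiagonally on the \<open>x\<^sub>n\<close> from some index on maps \<open>L\<^sub>n\<close> into \<open>L\<^sub>n\<^sub>+\<^sub>1\<close> for
  large \<open>n\<close>. Because the order alternates between the two ends of the exponent range, one further
  monomial leaves no room to raise a large positive exponent or to lower a large negative one. So
  \<open>p\<^sub>s\<close> vanishes near \<open>+\<infinity>\<close> for \<open>s > 0\<close> and near \<open>-\<infinity>\<close> for \<open>s < 0\<close>, and being polynomial it
  vanishes identically: \<open>D z\<^sup>m = p(m) z\<^sup>m\<close> (\<open>triangular_symbol_imp_diagonal\<close>).

  As \<open>D x\<^sub>n\<close> has no component along \<open>x\<^sub>k\<close> with \<open>k < n - 1\<close>, the adjoint of \<open>D\<close> is an operator on Laurent
  polynomials too, and it again maps \<open>L\<^sub>n\<close> into \<open>L\<^sub>n\<^sub>+\<^sub>1\<close> for large \<open>n\<close> (\<open>ex_adjoint\<close>). Let \<open>h\<^sub>m\<close>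
  be the image of \<open>z\<^sup>m\<close> under the adjoint and \<open>c\<^sub>i = \<integral> z\<^sup>i d\<mu>\<close>. Then \<open>\<langle>z\<^sup>i, z\<^sup>-\<^sup>m h\<^sub>m\<rangle> = p(i + m) c\<^sub>i\<close>, which is a polynomial in \<open>m\<close> of degree
  at most \<open>r\<close> for every \<open>i\<close>. The inner product is definite because the support is infinite, so the
  coefficients of \<open>z\<^sup>-\<^sup>m h\<^sub>m\<close> are polynomial in \<open>m\<close> as well, and the same principle gives
  \<open>h\<^sub>m = q(m) z\<^sup>m\<close>. Comparing both sides, \<open>p(i + m) c\<^sub>i = cnj (q(m)) c\<^sub>i\<close> for all \<open>i\<close> and \<open>m\<close>. The case
  \<open>i = 0\<close> identifies \<open>cnj (q(m))\<close> with \<open>p(m)\<close>; a moment \<open>c\<^sub>s \<noteq> 0\<close> with \<open>s \<noteq> 0\<close> would then make \<open>p\<close>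
  periodic, hence constant, which contradicts the order of \<open>D\<close> being at least one
  (\<open>moment_eq_zero\<close>). Thus all moments of \<open>\<mu>\<close> agree with those of Lebesgue measure, and the moments
  determine the measure (\<open>circle_prob_eqI\<close>).
\<close>

section \<open>Finite differences on the integers\<close>

text \<open>
  A function on the integers is polynomial of degree less than \<open>k\<close> exactly when its \<open>k\<close>-th difference
  vanishes. This description commutes with every additive map, so it transfers between a Laurent
  polynomial depending on \<open>m\<close>, its coefficients and its inner products.
\<close>

definition fdiff :: "(int \<Rightarrow> 'a::ab_group_add) \<Rightarrow> int \<Rightarrow> 'a" where
  "fdiff f m = f (m + 1) - f m"

lemma fdiff_const [simp]: "fdiff (\<lambda>_. c) = (\<lambda>_. 0)"
  by (simp add: fdiff_def fun_eq_iff)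

lemma funpow_fdiff_additive:
  assumes "\<And>x y. F (x - y) = F x - F y"
  shows "(fdiff ^^ k) (\<lambda>m. F (u m)) = (\<lambda>m. F ((fdiff ^^ k) u m))"
  by (induction k) (auto simp: fdiff_def assms)

lemma funpow_fdiff_mult_left:
  fixes f :: "int \<Rightarrow> 'a::ring"
  shows "(fdiff ^^ k) (\<lambda>m. c * f m) = (\<lambda>m. c * (fdiff ^^ k) f m)"
  by (rule funpow_fdiff_additive) (simp add: right_diff_distrib)

lemma funpow_fdiff_mult_right:
  fixes f :: "int \<Rightarrow> 'a::ring"
  shows "(fdiff ^^ k) (\<lambda>m. f m * c) = (\<lambda>m. (fdiff ^^ k) f m * c)"
  by (rule funpow_fdiff_additive) (simp add: left_diff_distrib)

lemma funpow_fdiff_shift: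
  "(fdiff ^^ k) (\<lambda>m. f (i + m)) = (\<lambda>m. (fdiff ^^ k) f (i + m))"
  by (induction k) (auto simp: fdiff_def algebra_simps)

lemma funpow_fdiff_sum:
  "(fdiff ^^ k) (\<lambda>m. \<Sum>i\<in>A. f i m) = (\<lambda>m. \<Sum>i\<in>A. (fdiff ^^ k) (f i) m)"
  by (induction k) (auto simp: fdiff_def sum_subtractf)

lemma fdiff_eq_zero_imp_const:
  assumes "fdiff f = (\<lambda>_. 0)"
  shows "f m = f 0"
proof (induction m rule: int_induct[where k = 0])
  case (step1 i)
  then show ?case using fun_cong[OF assms, of i] by (simp add: fdiff_def)
next
  case (step2 i)
  then show ?case using fun_cong[OF assms, of "i - 1"] by (simp add: fdiff_def)
qed auto

text \<open>
  A polynomial with infinitely many zeros vanishes; in terms of differences, the first difference is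
  eventually zero of lower degree, hence zero, and the function is an eventually vanishing constant.
\<close>

lemma funpow_fdiff_zero_eventually_zero_top:
  assumes "(fdiff ^^ k) f = (\<lambda>_. 0)" and "\<And>m. m \<ge> M \<Longrightarrow> f m = 0"
  shows "f m = 0"
  using assms
proof (induction k arbitrary: f m)
  case (Suc k)
  have "fdiff f n = 0" for n
  proof (rule Suc.IH)
    show "(fdiff ^^ k) (fdiff f) = (\<lambda>_. 0)"
      using Suc.prems(1) by (simp add: funpow_swap1)
  qed (simp add: fdiff_def Suc.prems(2))
  then have "f n = f 0" for n
    using fdiff_eq_zero_imp_const by blast
  then show ?case
    using Suc.prems(2)[of M] by (metis order_refl)
qed simp

lemma funpow_fdiff_zero_eventually_zero_bot:
  assumes "(fdiff ^^ k) f = (\<lambda>_. 0)" and "\<And>m. m \<le> M \<Longrightarrow> f m = 0"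
  shows "f m = 0"
  using assms
proof (induction k arbitrary: f m M)
  case (Suc k)
  have "fdiff f n = 0" for n
  proof (rule Suc.IH)
    show "(fdiff ^^ k) (fdiff f) = (\<lambda>_. 0)"
      using Suc.prems(1) by (simp add: funpow_swap1)
    show "fdiff f m = 0" if "m \<le> M - 1" for m
      using that by (simp add: fdiff_def Suc.prems(2))
  qed
  then have "f n = f 0" for n
    using fdiff_eq_zero_imp_const by blast
  then show ?case
    using Suc.prems(2)[of M] by (metis order_refl)
qed simp

text \<open>
  By induction on the degree the first difference, being periodic too, is a constant; then the function
  is affine, and an affine function with a nonzero period has slope zero.
\<close>

lemma funpow_fdiff_zero_periodic_imp_const:
  fixes f :: "int \<Rightarrow> 'a::{ring_1,ring_no_zero_divisors,ring_char_0}"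
  assumes "(fdiff ^^ k) f = (\<lambda>_. 0)" and "\<And>m. f (m + s) = f m" and "s \<noteq> 0"
  shows "f m = f 0"
  using assms(1,2)
proof (induction k arbitrary: f m)
  case (Suc k)
  have const: "fdiff f n = fdiff f 0" for n
  proof (rule Suc.IH)
    show "(fdiff ^^ k) (fdiff f) = (\<lambda>_. 0)"
      using Suc.prems(1) by (simp add: funpow_swap1)
    show "fdiff f (m + s) = fdiff f m" for m
      using Suc.prems(2)[of m] Suc.prems(2)[of "m + 1"] by (simp add: fdiff_def algebra_simps)
  qed
  define d where "d = fdiff f 0"
  have step: "f (n + 1) = f n + d" for n
    using const[of n] by (simp add: fdiff_def d_def algebra_simps)
  have lin: "f n = f 0 + of_int n * d" for n
  proof (induction n rule: int_induct[where k = 0])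
    case (step1 i)
    then show ?case using step[of i] by (simp add: algebra_simps)
  next
    case (step2 i)
    then show ?case using step[of "i - 1"] by (simp add: algebra_simps)
  qed auto
  have "d = 0"
    using lin[of s] Suc.prems(2)[of 0] \<open>s \<noteq> 0\<close> by simp
  then show ?case using lin[of m] by simp
qed simp

text \<open>
  The eigenvalue of \<open>z\<^sup>k (d/dz)\<^sup>k\<close> at \<open>z\<^sup>m\<close>.
\<close>

definition falling_fact :: "nat \<Rightarrow> int \<Rightarrow> complex" where
  "falling_fact k m = (\<Prod>i<k. of_int m - of_nat i)"

lemma falling_fact_0 [simp]: "falling_fact 0 = (\<lambda>_. 1)"
  by (simp add: falling_fact_def fun_eq_iff)

lemma falling_fact_Suc: "falling_fact (Suc k) m = falling_fact k m * (of_int m - of_nat k)"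
  by (simp add: falling_fact_def)

lemma falling_fact_Suc_shift:
  "falling_fact (Suc k) (m + 1) = of_int (m + 1) * falling_fact k m"
  unfolding falling_fact_def by (subst prod.lessThan_Suc_shift) simp

lemma fdiff_falling_fact: "fdiff (falling_fact (Suc k)) = (\<lambda>m. of_nat (Suc k) * falling_fact k m)"
  unfolding fdiff_def falling_fact_Suc_shift
  by (simp add: fun_eq_iff falling_fact_Suc algebra_simps)

lemma funpow_fdiff_falling_fact_same: "(fdiff ^^ k) (falling_fact k) = (\<lambda>_. fact k)"
proof (induction k)
  case (Suc k)
  then show ?case
    by (simp only: funpow_Suc_right o_apply fdiff_falling_fact funpow_fdiff_mult_left) simp
qed simp

lemma funpow_fdiff_falling_fact_less:
  assumes "k < n"
  shows "(fdiff ^^ n) (falling_fact k) = (\<lambda>_. 0)"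
proof -
  define d where "d = n - Suc k"
  have n: "n = d + 1 + k"
    using assms by (simp add: d_def)
  have "(fdiff ^^ n) (falling_fact k) = (fdiff ^^ d) (\<lambda>_. 0)"
    unfolding n funpow_add o_apply funpow_fdiff_falling_fact_same by simp
  also have "\<dots> = (\<lambda>_. 0)"
    by (induction d) simp_all
  finally show ?thesis .
qed

section \<open>Coefficients and values of Laurent polynomials\<close>

abbreviation zpow :: "int \<Rightarrow> laurent" where
  "zpow m \<equiv> Poly_Mapping.single m 1"

lemma zpow_nonzero: "zpow m \<noteq> 0"
  by (metis lookup_single_eq lookup_zero one_neq_zero)

lemma laurent_expand:
  fixes p :: laurent
  assumes "finite A" and "Poly_Mapping.keys p \<subseteq> A"
  shows "p = (\<Sum>k\<in>A. Poly_Mapping.single k (Poly_Mapping.lookup p k))"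
  using assms
  by (intro poly_mapping_eqI) (auto simp: lookup_sum lookup_single when_def in_keys_iff)

lemma lookup_single_mult:
  fixes p :: laurent
  shows "Poly_Mapping.lookup (Poly_Mapping.single a c * p) j = c * Poly_Mapping.lookup p (j - a)"
proof -
  have "Poly_Mapping.single a c * p
      = (\<Sum>k\<in>Poly_Mapping.keys p. Poly_Mapping.single (a + k) (c * Poly_Mapping.lookup p k))"
    by (subst (1) laurent_expand[of "Poly_Mapping.keys p" p]) (auto simp: sum_distrib_left mult_single)
  then have "Poly_Mapping.lookup (Poly_Mapping.single a c * p) j
      = (\<Sum>k\<in>Poly_Mapping.keys p. if k = j - a then c * Poly_Mapping.lookup p k else 0)"
    by (simp only: lookup_sum) (rule sum.cong, auto simp: lookup_single when_def)
  also have "\<dots> = c * Poly_Mapping.lookup p (j - a)"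
    by (simp add: in_keys_iff)
  finally show ?thesis .
qed

lemma lookup_laurent_scale [simp]:
  "Poly_Mapping.lookup (laurent_scale c p) j = c * Poly_Mapping.lookup p j"
  by (simp add: laurent_scale_def lookup_single_mult)

lemma laurent_scale_zpow: "laurent_scale c (zpow m) = Poly_Mapping.single m c"
  by (rule poly_mapping_eqI) (simp add: lookup_single when_def)

lemma keys_laurent_scale: "Poly_Mapping.keys (laurent_scale c p) \<subseteq> Poly_Mapping.keys p"
  by (auto simp: in_keys_iff)

lemma laurent_eval_superset:
  assumes "finite A" and "Poly_Mapping.keys p \<subseteq> A"
  shows "laurent_eval p z = (\<Sum>j\<in>A. Poly_Mapping.lookup p j * z powi j)"
  unfolding laurent_eval_def using assms by (intro sum.mono_neutral_left) (auto simp: in_keys_iff)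

lemma laurent_eval_add [simp]: "laurent_eval (p + q) z = laurent_eval p z + laurent_eval q z"
proof -
  define A where "A = Poly_Mapping.keys p \<union> Poly_Mapping.keys q"
  have A: "finite A" "Poly_Mapping.keys p \<subseteq> A" "Poly_Mapping.keys q \<subseteq> A"
    "Poly_Mapping.keys (p + q) \<subseteq> A"
    using keys_add[of p q] by (auto simp: A_def)
  show ?thesis
    unfolding A(2-4)[THEN laurent_eval_superset[OF A(1)]]
    by (simp add: lookup_add distrib_right sum.distrib)
qed

lemma laurent_eval_scale [simp]: "laurent_eval (laurent_scale c p) z = c * laurent_eval p z"
  by (subst laurent_eval_superset[OF finite_keys keys_laurent_scale])
    (simp add: laurent_eval_def sum_distrib_left mult.assoc)

lemma laurent_eval_zpow [simp]: "laurent_eval (zpow m) z = z powi m"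
  by (simp add: laurent_eval_def)

lemma laurent_eval_zero [simp]: "laurent_eval 0 z = 0"
  by (simp add: laurent_eval_def)

lemma laurent_eval_zpow_mult:
  assumes "z \<noteq> 0"
  shows "laurent_eval (zpow a * p) z = z powi a * laurent_eval p z"
proof -
  have "Poly_Mapping.keys (zpow a * p) \<subseteq> (+) a ` Poly_Mapping.keys p"
    using keys_mult[of "zpow a" p] by auto
  then have "laurent_eval (zpow a * p) z
      = (\<Sum>j\<in>Poly_Mapping.keys p. Poly_Mapping.lookup p j * z powi (a + j))"
    by (subst laurent_eval_superset[where A = "(+) a ` Poly_Mapping.keys p"])
      (auto simp: sum.reindex inj_on_def lookup_single_mult)
  then show ?thesis
    using assms by (simp add: laurent_eval_def power_int_add sum_distrib_left mult_ac)
qed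

lemma laurent_eval_sum: "laurent_eval (\<Sum>i\<in>A. f i) z = (\<Sum>i\<in>A. laurent_eval (f i) z)"
  by (induction A rule: infinite_finite_induct) simp_all

lemma laurent_eval_mult:
  assumes "z \<noteq> 0"
  shows "laurent_eval (p * q) z = laurent_eval p z * laurent_eval q z"
proof -
  have "p * q = (\<Sum>k\<in>Poly_Mapping.keys p. laurent_scale (Poly_Mapping.lookup p k) (zpow k)) * q"
    unfolding laurent_scale_zpow by (subst laurent_expand[of "Poly_Mapping.keys p" p]) auto
  also have "\<dots> = (\<Sum>k\<in>Poly_Mapping.keys p. laurent_scale (Poly_Mapping.lookup p k) (zpow k * q))"
    by (simp add: sum_distrib_right laurent_scale_def mult.assoc)
  finally show ?thesis
    using assms
    by (simp add: laurent_eval_sum laurent_eval_zpow_mult laurent_eval_def[of p] sum_distrib_right mult.assoc)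
qed

text \<open>
  Multiplication by a large power of \<open>z\<close> turns the Laurent polynomial into an ordinary nonzero
  polynomial.
\<close>

lemma finite_zeros_laurent_eval:
  assumes "p \<noteq> 0"
  shows "finite {z. z \<noteq> 0 \<and> laurent_eval p z = 0}"
proof -
  obtain N :: nat where N: "\<And>j. j \<in> Poly_Mapping.keys p \<Longrightarrow> \<bar>j\<bar> \<le> int N"
  proof
    fix j assume "j \<in> Poly_Mapping.keys p"
    then have "nat \<bar>j\<bar> \<le> Max ((\<lambda>j. nat \<bar>j\<bar>) ` Poly_Mapping.keys p)"
      by (intro Max_ge) auto
    then show "\<bar>j\<bar> \<le> int (Max ((\<lambda>j. nat \<bar>j\<bar>) ` Poly_Mapping.keys p))"
      by linarith
  qed
  define c where "c i = Poly_Mapping.lookup p (int i - int N)" for i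
  have sub: "Poly_Mapping.keys p \<subseteq> (\<lambda>i. int i - int N) ` {..2 * N}"
  proof
    fix j assume "j \<in> Poly_Mapping.keys p"
    with N[OF this] show "j \<in> (\<lambda>i. int i - int N) ` {..2 * N}"
      by (intro image_eqI[of _ _ "nat (j + int N)"]) auto
  qed
  have ev: "(\<Sum>i\<le>2 * N. c i * z ^ i) = z ^ N * laurent_eval p z" if "z \<noteq> 0" for z
  proof -
    have "laurent_eval p z = (\<Sum>i\<le>2 * N. c i * z powi (int i - int N))"
      by (subst laurent_eval_superset[OF _ sub])
        (auto simp: sum.reindex inj_on_def c_def)
    then show ?thesis
      using that by (simp add: sum_distrib_left power_int_diff)
  qed
  obtain j where "Poly_Mapping.lookup p j \<noteq> 0"
    using assms by (metis poly_mapping_eqI lookup_zero)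
  moreover obtain i where "i \<le> 2 * N" "j = int i - int N"
    using sub calculation by (auto simp: in_keys_iff image_iff)
  ultimately have "c i \<noteq> 0" by (simp add: c_def)
  then have "finite {z. (\<Sum>i\<le>2 * N. c i * z ^ i) = 0}"
    using \<open>i \<le> 2 * N\<close> polyfun_rootbound_finite[of "2 * N" c] by blast
  then show ?thesis
    by (rule rev_finite_subset) (auto simp: ev)
qed

section \<open>Symbols of differential operators\<close>

lemma lookup_laurent_deriv:
  "Poly_Mapping.lookup (laurent_deriv p) j = of_int (j + 1) * Poly_Mapping.lookup p (j + 1)"
proof -
  have "Poly_Mapping.lookup (laurent_deriv p) j
      = (\<Sum>k\<in>Poly_Mapping.keys p. if k = j + 1 then of_int k * Poly_Mapping.lookup p k else 0)"
    unfolding laurent_deriv_def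
    unfolding lookup_sum by (intro sum.cong) (auto simp: lookup_single when_def)
  then show ?thesis by (simp add: in_keys_iff)
qed

lemma laurent_deriv_add: "laurent_deriv (p + q) = laurent_deriv p + laurent_deriv q"
  by (rule poly_mapping_eqI) (simp add: lookup_laurent_deriv lookup_add algebra_simps)

lemma laurent_deriv_scale: "laurent_deriv (laurent_scale a p) = laurent_scale a (laurent_deriv p)"
  by (rule poly_mapping_eqI) (simp add: lookup_laurent_deriv algebra_simps)

lemma funpow_laurent_deriv_add:
  "(laurent_deriv ^^ k) (p + q) = (laurent_deriv ^^ k) p + (laurent_deriv ^^ k) q"
  by (induction k) (simp_all add: laurent_deriv_add)

lemma funpow_laurent_deriv_scale:
  "(laurent_deriv ^^ k) (laurent_scale a p) = laurent_scale a ((laurent_deriv ^^ k) p)"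
  by (induction k) (simp_all add: laurent_deriv_scale)

lemma funpow_laurent_deriv_zpow:
  "(laurent_deriv ^^ k) (zpow m) = Poly_Mapping.single (m - int k) (falling_fact k m)"
proof (induction k)
  case (Suc k)
  show ?case
    unfolding funpow.simps o_apply Suc.IH
    by (rule poly_mapping_eqI)
      (auto simp: lookup_laurent_deriv lookup_single when_def falling_fact_Suc)
qed simp

lemma linear_diff_operator_linear:
  assumes "linear_diff_operator r D"
  shows "D (p + q) = D p + D q" and "D (laurent_scale a p) = laurent_scale a (D p)"
proof -
  obtain c where D: "\<And>p. D p = (\<Sum>k\<le>r. c k * (laurent_deriv ^^ k) p)"
    using assms by (auto simp: linear_diff_operator_def)
  show "D (p + q) = D p + D q"
    by (simp add: D funpow_laurent_deriv_add distrib_left sum.distrib)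
  show "D (laurent_scale a p) = laurent_scale a (D p)"
    unfolding D funpow_laurent_deriv_scale laurent.scale_sum_right
    by (simp add: laurent_scale_def mult_ac)
qed

text \<open>
  The coefficient of \<open>z\<^bsup>m+s\<^esup>\<close> in \<open>D z\<^sup>m\<close> is a combination of the falling factorials of \<open>m\<close> of length at
  most \<open>r\<close>. The one of length \<open>r\<close> carries a coefficient of the nonzero leading Laurent polynomial, so
  for some \<open>s\<close> the degree \<open>r\<close> is attained.
\<close>

lemma linear_diff_operator_symbol:
  assumes "linear_diff_operator r D"
  shows "(fdiff ^^ Suc r) (\<lambda>m. Poly_Mapping.lookup (D (zpow m)) (m + s)) = (\<lambda>_. 0)"
    and "\<exists>s. (fdiff ^^ r) (\<lambda>m. Poly_Mapping.lookup (D (zpow m)) (m + s)) \<noteq> (\<lambda>_. 0)"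
proof -
  obtain c where "c r \<noteq> 0" and D: "\<And>p. D p = (\<Sum>k\<le>r. c k * (laurent_deriv ^^ k) p)"
    using assms by (auto simp: linear_diff_operator_def)
  have sym: "(\<lambda>m. Poly_Mapping.lookup (D (zpow m)) (m + s))
      = (\<lambda>m. \<Sum>k\<le>r. falling_fact k m * Poly_Mapping.lookup (c k) (s + int k))" for s
    unfolding D funpow_laurent_deriv_zpow lookup_sum
    by (subst mult.commute) (simp add: lookup_single_mult add.commute)
  have "(fdiff ^^ Suc r) (\<lambda>m. Poly_Mapping.lookup (D (zpow m)) (m + s))
      = (\<lambda>m. \<Sum>k\<le>r. (fdiff ^^ Suc r) (falling_fact k) m * Poly_Mapping.lookup (c k) (s + int k))"
    unfolding sym funpow_fdiff_sum funpow_fdiff_mult_right ..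
  also have "\<dots> = (\<lambda>_. 0)"
    by (rule ext, rule sum.neutral) (simp add: funpow_fdiff_falling_fact_less del: funpow.simps)
  finally show "(fdiff ^^ Suc r) (\<lambda>m. Poly_Mapping.lookup (D (zpow m)) (m + s)) = (\<lambda>_. 0)" .
  have top: "(fdiff ^^ r) (\<lambda>m. Poly_Mapping.lookup (D (zpow m)) (m + s))
      = (\<lambda>m. fact r * Poly_Mapping.lookup (c r) (s + int r))" for s
  proof -
    have "(fdiff ^^ r) (\<lambda>m. Poly_Mapping.lookup (D (zpow m)) (m + s))
      = (\<lambda>m. \<Sum>k\<le>r. (fdiff ^^ r) (falling_fact k) m * Poly_Mapping.lookup (c k) (s + int k))"
      unfolding sym funpow_fdiff_sum funpow_fdiff_mult_right ..
    also have "\<dots> = (\<lambda>m. \<Sum>k\<le>r. if k = r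
        then fact r * Poly_Mapping.lookup (c r) (s + int r) else 0)"
      by (intro ext sum.cong)
        (auto simp: funpow_fdiff_falling_fact_less funpow_fdiff_falling_fact_same)
    finally show ?thesis by simp
  qed
  obtain j where "Poly_Mapping.lookup (c r) j \<noteq> 0"
    using \<open>c r \<noteq> 0\<close> by (metis poly_mapping_eqI lookup_zero)
  then have "(fdiff ^^ r) (\<lambda>m. Poly_Mapping.lookup (D (zpow m)) (m + (j - int r))) \<noteq> (\<lambda>_. 0)"
    unfolding top by (simp add: fun_eq_iff)
  then show "\<exists>s. (fdiff ^^ r) (\<lambda>m. Poly_Mapping.lookup (D (zpow m)) (m + s)) \<noteq> (\<lambda>_. 0)" ..
qed

section \<open>The order of the exponents and triangular operators\<close>

definition olp_exponent :: "nat \<Rightarrow> int" where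
  "olp_exponent n = (if even n then int (n div 2) else - int (Suc n div 2))"

lemma laurent_basis_eq: "laurent_basis n = zpow (olp_exponent n)"
  by (simp add: laurent_basis_def olp_exponent_def)

lemma olp_exponent_even: "olp_exponent (2 * m) = int m"
  and olp_exponent_odd: "olp_exponent (2 * m + 1) = - int m - 1"
  by (simp_all add: olp_exponent_def)

lemma surj_olp_exponent: "\<exists>n. olp_exponent n = m"
proof (cases "m \<ge> 0")
  case True
  then show ?thesis using olp_exponent_even[of "nat m"] by auto
next
  case False
  then show ?thesis using olp_exponent_odd[of "nat (- m - 1)"] by auto
qed

lemma inj_olp_exponent: "inj olp_exponent"
proof (rule injI)
  fix i j assume "olp_exponent i = olp_exponent j"
  then show "i = j"
    by (cases "even i"; cases "even j") (auto simp: olp_exponent_def elim!: evenE oddE)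
qed

definition laurent_upto :: "nat \<Rightarrow> laurent set" where
  "laurent_upto n = {p. Poly_Mapping.keys p \<subseteq> olp_exponent ` {..n}}"

lemma laurent_upto_mono: "m \<le> n \<Longrightarrow> laurent_upto m \<subseteq> laurent_upto n"
  by (force simp: laurent_upto_def)

lemma subspace_laurent_upto: "laurent.subspace (laurent_upto n)"
proof (rule laurent.subspaceI)
  fix p q c assume "p \<in> laurent_upto n" "q \<in> laurent_upto n"
  then show "p + q \<in> laurent_upto n"
    using keys_add[of p q] by (auto simp: laurent_upto_def)
  show "laurent_scale c p \<in> laurent_upto n"
    using \<open>p \<in> laurent_upto n\<close> keys_laurent_scale[of c p] by (auto simp: laurent_upto_def)
qed (simp add: laurent_upto_def)

lemma basis_in_laurent_upto: "k \<le> n \<Longrightarrow> laurent_basis k \<in> laurent_upto n"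
  by (auto simp: laurent_upto_def laurent_basis_eq)

lemma ex_laurent_upto: "\<exists>n. p \<in> laurent_upto n"
proof -
  obtain f where f: "\<And>m. olp_exponent (f m) = m"
    using surj_olp_exponent by metis
  have "Poly_Mapping.keys p \<subseteq> olp_exponent ` {..Max (f ` Poly_Mapping.keys p)}"
  proof
    fix j assume "j \<in> Poly_Mapping.keys p"
    then have "f j \<le> Max (f ` Poly_Mapping.keys p)" by (intro Max_ge) auto
    then show "j \<in> olp_exponent ` {..Max (f ` Poly_Mapping.keys p)}"
      by (intro image_eqI[of _ _ "f j"]) (simp_all add: f)
  qed
  then show ?thesis by (auto simp: laurent_upto_def)
qed

lemma laurent_upto_span_basis: "laurent_upto n \<subseteq> laurent.span (laurent_basis ` {..n})"
proof
  fix p assume p: "p \<in> laurent_upto n"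
  have "p = (\<Sum>j\<in>Poly_Mapping.keys p. laurent_scale (Poly_Mapping.lookup p j) (zpow j))"
    unfolding laurent_scale_zpow by (rule laurent_expand) auto
  also have "\<dots> \<in> laurent.span (laurent_basis ` {..n})"
  proof (intro laurent.span_sum laurent.span_scale)
    fix j assume "j \<in> Poly_Mapping.keys p"
    then obtain k where "k \<le> n" "j = olp_exponent k"
      using p by (auto simp: laurent_upto_def)
    then show "zpow j \<in> laurent.span (laurent_basis ` {..n})"
      by (intro laurent.span_base) (auto simp: laurent_basis_eq)
  qed
  finally show "p \<in> laurent.span (laurent_basis ` {..n})" .
qed

lemma olp_exponent_le_even: "n \<le> 2 * m + 1 \<Longrightarrow> olp_exponent n \<le> int m"
  and olp_exponent_ge_odd: "n \<le> 2 * m + 2 \<Longrightarrow> - int m - 1 \<le> olp_exponent n"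
proof -
  show "n \<le> 2 * m + 1 \<Longrightarrow> olp_exponent n \<le> int m"
    by (cases "even n") (auto simp: olp_exponent_def elim!: evenE)
  show "n \<le> 2 * m + 2 \<Longrightarrow> - int m - 1 \<le> olp_exponent n"
    by (cases "even n") (auto simp: olp_exponent_def elim!: oddE)
qed

text \<open>
  The monomial with index \<open>2 m\<close> has exponent \<open>m\<close>, and the only monomial that the next space adds is
  \<open>z\<^bsup>-m-1\<^esup>\<close>, at the opposite end; likewise with the signs exchanged for odd indices. Hence upward
  shifts are impossible near \<open>+\<infinity>\<close> and downward shifts near \<open>-\<infinity>\<close>, and polynomiality of the symbols
  spreads this to all exponents.
\<close>

lemma triangular_symbol_imp_diagonal:
  assumes poly: "\<And>s. (fdiff ^^ k) (\<lambda>m. Poly_Mapping.lookup (E m) (m + s)) = (\<lambda>_. 0)"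
    and tri: "\<And>n. n \<ge> n0 \<Longrightarrow> E (olp_exponent n) \<in> laurent_upto (Suc n)"
  shows "E m = Poly_Mapping.single m (Poly_Mapping.lookup (E m) m)"
proof -
  have pos: "Poly_Mapping.lookup (E m) (m + s) = 0" if "s > 0" for m s
  proof (rule funpow_fdiff_zero_eventually_zero_top[OF poly])
    fix m :: int assume m: "m \<ge> int n0"
    then have "E m \<in> laurent_upto (2 * nat m + 1)"
      using tri[of "2 * nat m"] by (simp add: olp_exponent_even[of "nat m", simplified])
    then have "Poly_Mapping.keys (E m) \<subseteq> {.. m}"
      using m olp_exponent_le_even[of _ "nat m"] by (force simp: laurent_upto_def)
    then show "Poly_Mapping.lookup (E m) (m + s) = 0"
      using that by (auto simp: in_keys_iff)
  qed
  have neg: "Poly_Mapping.lookup (E m) (m + s) = 0" if "s < 0" for m s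
  proof (rule funpow_fdiff_zero_eventually_zero_bot[OF poly])
    fix m :: int assume m: "m \<le> - int n0 - 1"
    define l where "l = nat (- m - 1)"
    have m': "m = - int l - 1" using m by (simp add: l_def)
    have "E m \<in> laurent_upto (2 * l + 2)"
      using tri[of "2 * l + 1"] m unfolding olp_exponent_odd m' by simp
    then have "Poly_Mapping.keys (E m) \<subseteq> {m..}"
      using olp_exponent_ge_odd[of _ l] m' by (force simp: laurent_upto_def)
    then show "Poly_Mapping.lookup (E m) (m + s) = 0"
      using that by (auto simp: in_keys_iff)
  qed
  show ?thesis
  proof (rule poly_mapping_eqI)
    fix j
    show "Poly_Mapping.lookup (E m) j
        = Poly_Mapping.lookup (Poly_Mapping.single m (Poly_Mapping.lookup (E m) m)) j"
      using pos[of "j - m" m] neg[of "j - m" m]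
      by (cases j m rule: linorder_cases) (auto simp: lookup_single when_def)
  qed
qed

section \<open>The inner product of a measure on the circle\<close>

locale circle_prob = prob_space \<mu> for \<mu> :: "complex measure" +
  assumes sets_eq: "sets \<mu> = sets circle_borel"
begin

lemma space_eq: "space \<mu> = sphere 0 1"
  using sets_eq_imp_space_eq[OF sets_eq] by (simp add: circle_borel_def space_restrict_space)

lemma continuous_on_circle_measurable:
  fixes f :: "complex \<Rightarrow> 'b::topological_space"
  assumes "continuous_on (sphere 0 1) f"
  shows "f \<in> borel_measurable \<mu>"
  unfolding measurable_cong_sets[OF sets_eq refl] circle_borel_def
  by (rule borel_measurable_continuous_on_restrict[OF assms])

lemma continuous_on_circle_integrable:
  fixes f :: "complex \<Rightarrow> 'b::{banach,second_countable_topology}"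
  assumes "continuous_on (sphere 0 1) f"
  shows "integrable \<mu> f"
proof -
  have "compact (f ` sphere 0 1)"
    by (intro compact_continuous_image assms compact_sphere)
  then obtain B where "\<forall>x\<in>f ` sphere 0 1. norm x \<le> B"
    using compact_imp_bounded bounded_iff by blast
  then have "AE z in \<mu>. norm (f z) \<le> B"
    by (auto simp: space_eq)
  then show ?thesis
    using continuous_on_circle_measurable[OF assms] by (rule integrable_const_bound)
qed

lemma continuous_on_laurent_eval: "continuous_on (sphere 0 1) (laurent_eval p)"
  unfolding laurent_eval_def by (intro continuous_intros) auto

lemma integrable_laurent_inner:
  "integrable \<mu> (\<lambda>z. laurent_eval p z * cnj (laurent_eval q z))"
  by (intro continuous_on_circle_integrable continuous_intros continuous_on_laurent_eval)

lemma inner_add_left: "laurent_inner \<mu> (p + q) r = laurent_inner \<mu> p r + laurent_inner \<mu> q r"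
  by (simp add: laurent_inner_def distrib_right integrable_laurent_inner)

lemma inner_scale_left: "laurent_inner \<mu> (laurent_scale c p) q = c * laurent_inner \<mu> p q"
  by (simp add: laurent_inner_def mult.assoc integrable_laurent_inner)

lemma inner_commute: "laurent_inner \<mu> q p = cnj (laurent_inner \<mu> p q)"
  unfolding laurent_inner_def by (subst Bochner_Integration.integral_cnj[symmetric]) (simp add: mult.commute)

lemma inner_add_right: "laurent_inner \<mu> r (p + q) = laurent_inner \<mu> r p + laurent_inner \<mu> r q"
  by (subst (1 2 3) inner_commute) (simp add: inner_add_left)

lemma inner_scale_right: "laurent_inner \<mu> q (laurent_scale c p) = cnj c * laurent_inner \<mu> q p"
  by (subst (1 2) inner_commute) (simp add: inner_scale_left)

lemma inner_zero_left [simp]: "laurent_inner \<mu> 0 q = 0"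
  by (simp add: laurent_inner_def)

lemma inner_zero_right [simp]: "laurent_inner \<mu> q 0 = 0"
  by (simp add: laurent_inner_def)

lemma inner_diff_left: "laurent_inner \<mu> (p - q) r = laurent_inner \<mu> p r - laurent_inner \<mu> q r"
  using inner_add_left[of "p - q" q r] by simp

lemma inner_diff_right: "laurent_inner \<mu> r (p - q) = laurent_inner \<mu> r p - laurent_inner \<mu> r q"
  using inner_add_right[of r "p - q" q] by simp

lemma inner_sum_left: "laurent_inner \<mu> (\<Sum>i\<in>A. f i) q = (\<Sum>i\<in>A. laurent_inner \<mu> (f i) q)"
  by (induction A rule: infinite_finite_induct) (simp_all add: inner_add_left)

lemma inner_sum_right: "laurent_inner \<mu> q (\<Sum>i\<in>A. f i) = (\<Sum>i\<in>A. laurent_inner \<mu> q (f i))"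
  by (induction A rule: infinite_finite_induct) (simp_all add: inner_add_right)

text \<open>
  Multiplication by \<open>z\<^sup>a\<close> is unitary, as \<open>z\<close> has modulus one on the circle.
\<close>

lemma inner_shift:
  "laurent_inner \<mu> (zpow a * p) (zpow a * q) = laurent_inner \<mu> p q"
  unfolding laurent_inner_def
proof (rule Bochner_Integration.integral_cong)
  fix z assume "z \<in> space \<mu>"
  then have z: "norm z = 1" "z \<noteq> 0" by (auto simp: space_eq)
  have unit: "z powi a * cnj (z powi a) = 1"
    using z by (simp add: complex_norm_square[symmetric] norm_power_int del: complex_cnj_power_int)
  have "z powi a * x * (cnj (z powi a) * y) = (z powi a * cnj (z powi a)) * (x * y)" for x y
    by (simp only: mult_ac)
  then have "z powi a * x * (cnj (z powi a) * y) = x * y" for x y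
    unfolding unit by simp
  then show "laurent_eval (zpow a * p) z * cnj (laurent_eval (zpow a * q) z)
      = laurent_eval p z * cnj (laurent_eval q z)"
    using z by (simp add: laurent_eval_zpow_mult del: complex_cnj_power_int)
qed simp

lemma inner_zpow: "laurent_inner \<mu> (zpow i) (zpow j) = (LINT z|\<mu>. z powi (i - j))"
  unfolding laurent_inner_def
proof (rule Bochner_Integration.integral_cong)
  fix z assume "z \<in> space \<mu>"
  then have z: "norm z = 1" "z \<noteq> 0" by (auto simp: space_eq)
  then have "z * cnj z = 1"
    by (simp add: complex_norm_square[symmetric])
  then have "cnj z = inverse z"
    by (rule inverse_unique[symmetric])
  then have "cnj (z powi j) = inverse (z powi j)"
    by (simp only: complex_cnj_power_int power_int_inverse)
  then show "laurent_eval (zpow i) z * cnj (laurent_eval (zpow j) z) = z powi (i - j)"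
    by (simp only: laurent_eval_zpow power_int_diff[OF disjI1[OF z(2)]] divide_inverse)
qed simp

lemma inner_self: "laurent_inner \<mu> p p = of_real ((laurent_norm \<mu> p)\<^sup>2)"
proof -
  have "laurent_inner \<mu> p p = (LINT z|\<mu>. complex_of_real ((cmod (laurent_eval p z))\<^sup>2))"
    unfolding laurent_inner_def complex_norm_square ..
  also have "\<dots> = of_real (LINT z|\<mu>. (cmod (laurent_eval p z))\<^sup>2)"
    by (rule integral_complex_of_real)
  finally show ?thesis by (simp add: laurent_norm_def)
qed

end

section \<open>Orthonormal Laurent polynomials\<close>

locale circle_prob_inf = circle_prob +
  assumes inf_supp: "infinite (measure_support \<mu>)"
begin

text \<open>
  If the integral of \<open>\<bar>p\<bar>\<^sup>2\<close> vanishes, then the relatively open set where \<open>p\<close> is nonzero is null and so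
  misses the support. The support then lies in the zero set of \<open>p\<close>, which is finite for \<open>p \<noteq> 0\<close>.
\<close>

lemma inner_self_eq_0_iff: "laurent_inner \<mu> p p = 0 \<longleftrightarrow> p = 0"
proof
  assume 0: "laurent_inner \<mu> p p = 0"
  show "p = 0"
  proof (rule ccontr)
    assume "p \<noteq> 0"
    let ?f = "\<lambda>z. (cmod (laurent_eval p z))\<^sup>2"
    have int: "integrable \<mu> ?f"
      by (intro continuous_on_circle_integrable continuous_intros continuous_on_laurent_eval)
    have "(LINT z|\<mu>. ?f z) = 0"
      using 0 by (simp add: inner_self laurent_norm_def)
    then have ae: "AE z in \<mu>. laurent_eval p z = 0"
      using integral_nonneg_eq_0_iff_AE[OF int] by simp
    have "measure_support \<mu> \<subseteq> {z. z \<noteq> 0 \<and> laurent_eval p z = 0}"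
    proof (rule subsetI, rule ccontr)
      fix z assume z: "z \<in> measure_support \<mu>" "z \<notin> {z. z \<noteq> 0 \<and> laurent_eval p z = 0}"
      then have zs: "z \<in> sphere 0 1" by (simp add: measure_support_def space_eq)
      with z have nz: "laurent_eval p z \<noteq> 0" by auto
      have "openin (top_of_set (sphere 0 1)) (sphere 0 1 \<inter> laurent_eval p -` (- {0}))"
        by (intro continuous_openin_preimage_gen continuous_on_laurent_eval) auto
      then obtain U where U: "open U" "sphere 0 1 \<inter> laurent_eval p -` (- {0}) = U \<inter> sphere 0 1"
        unfolding openin_open by blast
      have "z \<in> U" using U(2) zs nz by blast
      then have "emeasure \<mu> (U \<inter> space \<mu>) > 0"
        using z(1) U(1) by (auto simp: measure_support_def)
      moreover have "emeasure \<mu> (U \<inter> space \<mu>) = 0"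
      proof -
        have *: "U \<inter> space \<mu> = {z\<in>space \<mu>. laurent_eval p z \<noteq> 0}"
          unfolding space_eq using U(2) by blast
        have "laurent_eval p -` (- {0}) \<inter> space \<mu> \<in> sets \<mu>"
          by (rule measurable_sets[OF continuous_on_circle_measurable[OF continuous_on_laurent_eval]]) simp
        also have "laurent_eval p -` (- {0}) \<inter> space \<mu> = {z\<in>space \<mu>. \<not> laurent_eval p z = 0}"
          by auto
        finally have "emeasure \<mu> {z\<in>space \<mu>. \<not> laurent_eval p z = 0} = 0"
          using iffD1[OF AE_iff_measurable[OF _ refl] ae] by simp
        then show ?thesis
          unfolding * .
      qed
      ultimately show False by simp
    qed
    then show False
      using inf_supp finite_zeros_laurent_eval[OF \<open>p \<noteq> 0\<close>] finite_subset by blast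
  qed
qed simp

lemma norm_pos: "p \<noteq> 0 \<Longrightarrow> laurent_norm \<mu> p > 0"
  using inner_self_eq_0_iff[of p] unfolding inner_self
  by (simp add: laurent_norm_def less_le integral_nonneg)

lemma eq_zero_if_orthogonal_zpow:
  assumes "\<And>i. laurent_inner \<mu> (zpow i) v = 0"
  shows "v = 0"
proof -
  define w where "w = (\<Sum>k\<in>Poly_Mapping.keys v. laurent_scale (Poly_Mapping.lookup v k) (zpow k))"
  have "laurent_inner \<mu> w v = 0"
    by (simp add: w_def inner_sum_left inner_scale_left assms)
  moreover have "w = v"
    unfolding w_def laurent_scale_zpow by (rule laurent_expand[symmetric]) auto
  ultimately have "laurent_inner \<mu> v v = 0"
    by simp
  then show ?thesis by (simp add: inner_self_eq_0_iff)
qed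

definition olp_residual :: "nat \<Rightarrow> laurent" where
  "olp_residual n = laurent_basis n -
    (\<Sum>k<n. laurent_scale (laurent_inner \<mu> (laurent_basis n) (olp \<mu> k)) (olp \<mu> k))"

lemma olp_eq:
  "olp \<mu> n = laurent_scale (of_real (1 / laurent_norm \<mu> (olp_residual n))) (olp_residual n)"
  by (subst olp.simps) (simp add: olp_residual_def Let_def)

lemma olp_in_laurent_upto: "olp \<mu> n \<in> laurent_upto n"
proof (induction n rule: less_induct)
  case (less n)
  have "olp \<mu> k \<in> laurent_upto n" if "k < n" for k
    using less[OF that] laurent_upto_mono[of k n] that by auto
  then have "olp_residual n \<in> laurent_upto n"
    unfolding olp_residual_def
    by (intro laurent.subspace_diff laurent.subspace_sum laurent.subspace_scale
        subspace_laurent_upto basis_in_laurent_upto) auto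
  then show ?case
    unfolding olp_eq by (intro laurent.subspace_scale subspace_laurent_upto)
qed

lemma olp_residual_nonzero: "olp_residual n \<noteq> 0"
proof -
  have "Poly_Mapping.lookup (olp \<mu> k) (olp_exponent n) = 0" if "k < n" for k
    using olp_in_laurent_upto[of k] that inj_olp_exponent
    by (fastforce simp: laurent_upto_def in_keys_iff dest: injD)
  then have "Poly_Mapping.lookup (olp_residual n) (olp_exponent n) = 1"
    by (simp add: olp_residual_def laurent_basis_eq lookup_minus lookup_sum)
  then show ?thesis by auto
qed

lemma olp_orthonormal_aux: "k \<le> n \<Longrightarrow> laurent_inner \<mu> (olp \<mu> n) (olp \<mu> k) = (if k = n then 1 else 0)"
proof (induction n arbitrary: k rule: less_induct)
  case (less n)
  let ?y = "olp_residual n"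
  define N where "N = laurent_norm \<mu> ?y"
  have N: "N > 0"
    unfolding N_def by (rule norm_pos[OF olp_residual_nonzero])
  have x: "olp \<mu> n = laurent_scale (of_real (1 / N)) ?y"
    unfolding N_def by (rule olp_eq)
  show ?case
  proof (cases "k = n")
    case True
    have "laurent_inner \<mu> (olp \<mu> n) (olp \<mu> n) = of_real ((1 / N) * ((1 / N) * N\<^sup>2))"
      unfolding x inner_scale_left inner_scale_right inner_self[of ?y] N_def[symmetric] by simp
    also have "\<dots> = 1" using N by (simp add: power2_eq_square)
    finally show ?thesis using True by simp
  next
    case False
    then have kn: "k < n" using less.prems by simp
    have orth: "laurent_inner \<mu> (olp \<mu> j) (olp \<mu> k) = (if j = k then 1 else 0)" if "j < n" for j
    proof (cases "k \<le> j")
      case True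
      then show ?thesis using less.IH[OF that True] by auto
    next
      case False
      then show ?thesis using less.IH[OF kn, of j] inner_commute[of "olp \<mu> j" "olp \<mu> k"] by auto
    qed
    have "laurent_inner \<mu> ?y (olp \<mu> k) = laurent_inner \<mu> (laurent_basis n) (olp \<mu> k)
        - (\<Sum>j<n. if j = k then laurent_inner \<mu> (laurent_basis n) (olp \<mu> j) else 0)"
      unfolding olp_residual_def inner_diff_left inner_sum_left inner_scale_left
      by (intro arg_cong2[where f = "(-)"] sum.cong refl) (simp add: orth)
    also have "\<dots> = 0" using kn by simp
    finally show ?thesis using False by (simp add: x inner_scale_left)
  qed
qed

lemma olp_orthonormal: "laurent_inner \<mu> (olp \<mu> n) (olp \<mu> k) = (if k = n then 1 else 0)"
proof (cases "k \<le> n")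
  case False
  then show ?thesis using olp_orthonormal_aux[of n k] inner_commute[of "olp \<mu> n" "olp \<mu> k"] by auto
qed (rule olp_orthonormal_aux)

text \<open>
  The Gram--Schmidt step can be inverted because the norm of the residual is positive.
\<close>

lemma laurent_upto_eq_span: "laurent_upto n = laurent.span (olp \<mu> ` {..n})"
proof
  have "olp \<mu> ` {..n} \<subseteq> laurent_upto n"
    using olp_in_laurent_upto laurent_upto_mono by fastforce
  then show "laurent.span (olp \<mu> ` {..n}) \<subseteq> laurent_upto n"
    by (rule laurent.span_minimal[OF _ subspace_laurent_upto])
  have "laurent_basis k \<in> laurent.span (olp \<mu> ` {..n})" if "k \<le> n" for k
  proof -
    define N where "N = laurent_norm \<mu> (olp_residual k)"
    have N: "N > 0"
      unfolding N_def by (rule norm_pos[OF olp_residual_nonzero])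
    have "olp_residual k = laurent_scale (of_real N) (olp \<mu> k)"
      unfolding olp_eq[of k] N_def[symmetric] using N by simp
    then have "laurent_basis k = laurent_scale (of_real N) (olp \<mu> k) +
        (\<Sum>j<k. laurent_scale (laurent_inner \<mu> (laurent_basis k) (olp \<mu> j)) (olp \<mu> j))"
      by (simp add: olp_residual_def diff_eq_eq)
    also have "\<dots> \<in> laurent.span (olp \<mu> ` {..n})"
      using that
      by (intro laurent.span_add laurent.span_sum laurent.span_scale laurent.span_base imageI) auto
    finally show ?thesis .
  qed
  then have "laurent_basis ` {..n} \<subseteq> laurent.span (olp \<mu> ` {..n})" by auto
  then show "laurent_upto n \<subseteq> laurent.span (olp \<mu> ` {..n})"
    using laurent_upto_span_basis laurent.span_minimal[OF _ laurent.subspace_span] by blast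
qed

lemma olp_orthogonal_laurent_upto:
  assumes "N < n" and "q \<in> laurent_upto N"
  shows "laurent_inner \<mu> (olp \<mu> n) q = 0" and "laurent_inner \<mu> q (olp \<mu> n) = 0"
proof -
  have "q \<in> laurent.span (olp \<mu> ` {..N})" using assms by (simp add: laurent_upto_eq_span)
  moreover have "laurent.subspace {q. laurent_inner \<mu> q (olp \<mu> n) = 0}"
    by (rule laurent.subspaceI) (simp_all add: inner_add_left inner_scale_left)
  moreover have "olp \<mu> ` {..N} \<subseteq> {q. laurent_inner \<mu> q (olp \<mu> n) = 0}"
    using \<open>N < n\<close> by (auto simp: olp_orthonormal)
  ultimately show "laurent_inner \<mu> q (olp \<mu> n) = 0"
    using laurent.span_minimal by blast
  then show "laurent_inner \<mu> (olp \<mu> n) q = 0" by (subst inner_commute) simp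
qed

lemma olp_induct:
  assumes "laurent.subspace S" and "\<And>n. olp \<mu> n \<in> S"
  shows "p \<in> S"
proof -
  obtain n where "p \<in> laurent_upto n" using ex_laurent_upto by blast
  moreover have "laurent.span (olp \<mu> ` {..n}) \<subseteq> S"
    using assms by (intro laurent.span_minimal) auto
  ultimately show ?thesis unfolding laurent_upto_eq_span by blast
qed

end

section \<open>Operators acting tridiagonally\<close>

text \<open>
  Linearity and bandwidth give the adjoint and triangularity; the differential structure enters
  through the symbols.
\<close>

locale olp_tridiagonal = circle_prob_inf +
  fixes D :: "laurent \<Rightarrow> laurent" and n0 :: nat
  assumes D_add: "D (p + q) = D p + D q"
    and D_scale: "D (laurent_scale a p) = laurent_scale a (D p)"
    and D_olp: "n \<ge> n0 \<Longrightarrow>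
      D (olp \<mu> n) \<in> laurent.span {olp \<mu> (n - 1), olp \<mu> n, olp \<mu> (n + 1)}"
begin

lemma D_zero: "D 0 = 0"
  using D_add[of 0 0] by simp

lemma subspace_preimage:
  assumes "laurent.subspace S"
  shows "laurent.subspace {p. D p \<in> S}"
  using assms by (auto intro!: laurent.subspaceI simp: D_zero D_add D_scale
      laurent.subspace_0 laurent.subspace_add laurent.subspace_scale)

lemma D_olp_in_laurent_upto: "n \<ge> n0 \<Longrightarrow> D (olp \<mu> n) \<in> laurent_upto (Suc n)"
proof -
  assume n: "n \<ge> n0"
  have "olp \<mu> k \<in> laurent_upto (Suc n)" if "k \<le> Suc n" for k
    using olp_in_laurent_upto laurent_upto_mono[OF that] by blast
  then have "{olp \<mu> (n - 1), olp \<mu> n, olp \<mu> (n + 1)} \<subseteq> laurent_upto (Suc n)"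
    by simp
  then show ?thesis
    using D_olp[OF n] laurent.span_minimal[OF _ subspace_laurent_upto] by blast
qed

text \<open>
  The finitely many \<open>x\<^sub>k\<close> with \<open>k < n0\<close> have images in some fixed space \<open>L\<^sub>M\<close>, which is absorbed once
  \<open>n \<ge> M\<close>.
\<close>

lemma eventually_triangular: "\<exists>M. \<forall>n\<ge>M. D (zpow (olp_exponent n)) \<in> laurent_upto (Suc n)"
proof -
  have "\<forall>k. \<exists>m. D (olp \<mu> k) \<in> laurent_upto m"
    using ex_laurent_upto by blast
  then obtain f where f: "\<And>k. D (olp \<mu> k) \<in> laurent_upto (f k)"
    by metis
  define M where "M = (\<Sum>k<n0. f k)"
  have M: "f k \<le> M" if "k < n0" for k
    unfolding M_def using that by (intro member_le_sum) auto
  have "D (zpow (olp_exponent n)) \<in> laurent_upto (Suc n)" if "n \<ge> M" for n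
  proof -
    have "D (olp \<mu> k) \<in> laurent_upto (Suc n)" if "k \<le> n" for k
    proof (cases "k < n0")
      case True
      then have "f k \<le> Suc n" using M[of k] \<open>n \<ge> M\<close> by simp
      then show ?thesis using f laurent_upto_mono by blast
    next
      case False
      then show ?thesis using D_olp_in_laurent_upto[of k] laurent_upto_mono[of "Suc k" "Suc n"] that
        by auto
    qed
    then have "laurent.span (olp \<mu> ` {..n}) \<subseteq> {p. D p \<in> laurent_upto (Suc n)}"
      by (intro laurent.span_minimal subspace_preimage subspace_laurent_upto) auto
    then show ?thesis
      using basis_in_laurent_upto[of n n] by (auto simp: laurent_upto_eq_span laurent_basis_eq)
  qed
  then show ?thesis by blast
qed

text \<open>
  For \<open>e\<close> in \<open>L\<^sub>N\<close> the functional \<open>p \<mapsto> \<langle>D p, e\<rangle>\<close> kills \<open>x\<^sub>n\<close> as soon as \<open>n \<ge> n0\<close> and \<open>n - 1 > N\<close>, since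
  \<open>D x\<^sub>n\<close> then has no component in \<open>L\<^sub>N\<close>. A functional with finitely many nonzero values on an
  orthonormal basis is represented by a finite combination of that basis.
\<close>

lemma ex_adjoint:
  "\<exists>h. (\<forall>p. laurent_inner \<mu> (D p) (zpow (olp_exponent N)) = laurent_inner \<mu> p h) \<and>
     h \<in> laurent_upto (max (Suc N) n0)"
proof -
  let ?e = "zpow (olp_exponent N)"
  define K where "K = max (Suc N) n0"
  define h where "h = (\<Sum>k\<le>K. laurent_scale (cnj (laurent_inner \<mu> (D (olp \<mu> k)) ?e)) (olp \<mu> k))"
  have sub: "laurent.subspace {p. laurent_inner \<mu> (D p) ?e = laurent_inner \<mu> p h}"
    by (rule laurent.subspaceI)
      (simp_all add: D_zero D_add D_scale inner_add_left inner_scale_left)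
  have "laurent_inner \<mu> (D (olp \<mu> n)) ?e = laurent_inner \<mu> (olp \<mu> n) h" for n
  proof (cases "n \<le> K")
    case True
    have "laurent_inner \<mu> (olp \<mu> n) h
        = (\<Sum>k\<le>K. if k = n then laurent_inner \<mu> (D (olp \<mu> k)) ?e else 0)"
      unfolding h_def inner_sum_right inner_scale_right olp_orthonormal by (rule sum.cong) auto
    then show ?thesis using True by (simp only: sum.delta finite_atMost) simp
  next
    case False
    have "laurent_inner \<mu> (olp \<mu> n) h = 0"
      unfolding h_def inner_sum_right inner_scale_right using False
      by (auto simp: olp_orthonormal intro!: sum.neutral)
    moreover have "laurent_inner \<mu> (D (olp \<mu> n)) ?e = 0"
    proof -
      have e: "?e \<in> laurent_upto N"
        using basis_in_laurent_upto[of N N] by (simp add: laurent_basis_eq)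
      have "laurent.subspace {p. laurent_inner \<mu> p ?e = 0}"
        by (rule laurent.subspaceI) (simp_all add: inner_add_left inner_scale_left)
      moreover have "{olp \<mu> (n - 1), olp \<mu> n, olp \<mu> (n + 1)} \<subseteq> {p. laurent_inner \<mu> p ?e = 0}"
        using False olp_orthogonal_laurent_upto(1)[OF _ e] by (auto simp: K_def)
      ultimately have "laurent.span {olp \<mu> (n - 1), olp \<mu> n, olp \<mu> (n + 1)}
          \<subseteq> {p. laurent_inner \<mu> p ?e = 0}"
        by (intro laurent.span_minimal)
      then show ?thesis using D_olp[of n] False unfolding K_def by fastforce
    qed
    ultimately show ?thesis by simp
  qed
  then have "laurent_inner \<mu> (D p) ?e = laurent_inner \<mu> p h" for p
    using olp_induct[OF sub] by simp
  moreover have "h \<in> laurent_upto K"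
  proof -
    have "olp \<mu> k \<in> laurent_upto K" if "k \<le> K" for k
      using olp_in_laurent_upto laurent_upto_mono[OF that] by blast
    then show ?thesis
      unfolding h_def
      by (intro laurent.subspace_sum laurent.subspace_scale subspace_laurent_upto) auto
  qed
  ultimately show ?thesis unfolding K_def by blast
qed

text \<open>
  The rigidity principle applies first to \<open>D\<close> and then to its adjoint; comparing the two diagonal
  operators shows that a nonzero moment of index \<open>s\<close> is a period of the symbol of \<open>D\<close>.
\<close>

lemma moment_eq_zero:
  assumes D: "linear_diff_operator r D" and "r \<ge> 1" and "s \<noteq> 0"
  shows "(LINT z|\<mu>. z powi s) = 0"
proof (rule ccontr)
  assume nz: "(LINT z|\<mu>. z powi s) \<noteq> 0"
  define p where "p m = Poly_Mapping.lookup (D (zpow m)) m" for m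
  obtain M where "\<And>n. n \<ge> M \<Longrightarrow> D (zpow (olp_exponent n)) \<in> laurent_upto (Suc n)"
    using eventually_triangular by blast
  then have D_diag: "D (zpow m) = laurent_scale (p m) (zpow m)" for m
    unfolding p_def laurent_scale_zpow by (rule triangular_symbol_imp_diagonal[OF linear_diff_operator_symbol(1)[OF D]])
  have p_poly: "(fdiff ^^ Suc r) p = (\<lambda>_. 0)"
    using linear_diff_operator_symbol(1)[OF D, of 0] by (simp only: add_0_right p_def[abs_def])
  obtain g where g: "\<And>N p. laurent_inner \<mu> (D p) (zpow (olp_exponent N)) = laurent_inner \<mu> p (g N)"
    and g_upto: "\<And>N. g N \<in> laurent_upto (max (Suc N) n0)"
    using ex_adjoint by metis
  obtain idx where idx: "\<And>m. olp_exponent (idx m) = m"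
    using surj_olp_exponent by metis
  have idx': "idx (olp_exponent n) = n" for n
    using injD[OF inj_olp_exponent idx] .
  define h where "h m = g (idx m)" for m
  have h: "laurent_inner \<mu> (D q) (zpow m) = laurent_inner \<mu> q (h m)" for q m
    using g[of q "idx m"] by (simp add: h_def idx)
  have h_upto: "h (olp_exponent n) \<in> laurent_upto (Suc n)" if "n \<ge> n0" for n
    using g_upto[of n] that by (simp add: h_def idx' max_def split: if_splits)
  (* Both sides are <D z^(i+m), z^m>: computed from the diagonal form of D on the left, moved to the
     adjoint and shifted by z^(-m) on the right. The moment c_i is written as <z^i, z^0>. *)
  have symbol: "p (i + m) * laurent_inner \<mu> (zpow i) (zpow 0) = laurent_inner \<mu> (zpow i) (zpow (- m) * h m)"
    for i m
  proof -
    have "p (i + m) * laurent_inner \<mu> (zpow i) (zpow 0) = laurent_inner \<mu> (D (zpow (i + m))) (zpow m)"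
      unfolding D_diag inner_scale_left inner_zpow by simp
    also have "\<dots> = laurent_inner \<mu> (zpow m * zpow i) (zpow m * (zpow (- m) * h m))"
      unfolding h mult.assoc[symmetric] mult_single by (simp add: add.commute)
    also have "\<dots> = laurent_inner \<mu> (zpow i) (zpow (- m) * h m)"
      by (rule inner_shift)
    finally show ?thesis .
  qed
  have "(fdiff ^^ Suc r) (\<lambda>m. zpow (- m) * h m) m = 0" for m
  proof (rule eq_zero_if_orthogonal_zpow)
    fix i
    have "(\<lambda>m. laurent_inner \<mu> (zpow i) ((fdiff ^^ Suc r) (\<lambda>m. zpow (- m) * h m) m))
        = (fdiff ^^ Suc r) (\<lambda>m. p (i + m) * laurent_inner \<mu> (zpow i) (zpow 0))"
      unfolding symbol by (rule funpow_fdiff_additive[symmetric]) (rule inner_diff_right)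
    also have "\<dots> = (\<lambda>_. 0)"
      unfolding funpow_fdiff_mult_right funpow_fdiff_shift p_poly by simp
    finally show "laurent_inner \<mu> (zpow i) ((fdiff ^^ Suc r) (\<lambda>m. zpow (- m) * h m) m) = 0"
      by (rule fun_cong)
  qed
  then have "(fdiff ^^ Suc r) (\<lambda>m. Poly_Mapping.lookup (zpow (- m) * h m) t) = (\<lambda>_. 0)" for t
    by (subst funpow_fdiff_additive[where F = "\<lambda>q. Poly_Mapping.lookup q t"])
      (auto simp: lookup_minus simp del: funpow.simps)
  moreover have "Poly_Mapping.lookup (zpow (- m) * h m) t = Poly_Mapping.lookup (h m) (m + t)" for m t
    by (simp add: lookup_single_mult add.commute)
  ultimately have "(fdiff ^^ Suc r) (\<lambda>m. Poly_Mapping.lookup (h m) (m + t)) = (\<lambda>_. 0)" for t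
    by simp
  then have h_diag: "h m = Poly_Mapping.single m (Poly_Mapping.lookup (h m) m)" for m
    using h_upto by (rule triangular_symbol_imp_diagonal)
  (* Both operators are now diagonal, and symbol compares their eigenvalues. *)
  have p_cnj: "p (i + m) * laurent_inner \<mu> (zpow i) (zpow 0)
      = cnj (Poly_Mapping.lookup (h m) m) * laurent_inner \<mu> (zpow i) (zpow 0)" for i m
  proof -
    have "zpow (- m) * h m = laurent_scale (Poly_Mapping.lookup (h m) m) (zpow 0)"
      unfolding laurent_scale_zpow by (subst h_diag) (simp add: mult_single)
    then show ?thesis
      unfolding symbol by (simp add: inner_scale_right)
  qed
  have "p m = cnj (Poly_Mapping.lookup (h m) m)" for m
    using p_cnj[of 0 m] unfolding inner_zpow by (simp add: prob_space)
  then have "p (m + s) = p m" for m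
    using p_cnj[of s m] nz unfolding inner_zpow by (simp add: add.commute)
  then have const: "p m = p 0" for m
    using p_poly \<open>s \<noteq> 0\<close> by (intro funpow_fdiff_zero_periodic_imp_const)
  have "(fdiff ^^ r) (\<lambda>m. Poly_Mapping.lookup (D (zpow m)) (m + t)) = (\<lambda>_. 0)" for t
  proof -
    have "(\<lambda>m. Poly_Mapping.lookup (D (zpow m)) (m + t)) = (\<lambda>_. if t = 0 then p 0 else 0)"
    proof (rule ext)
      fix m
      show "Poly_Mapping.lookup (D (zpow m)) (m + t) = (if t = 0 then p 0 else 0)"
        by (simp add: D_diag const[of m] lookup_single when_def)
    qed
    moreover obtain d where "r = Suc d" using \<open>r \<ge> 1\<close> by (cases r) auto
    moreover have "(fdiff ^^ d) (\<lambda>_. 0 :: complex) = (\<lambda>_. 0)"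
      by (induction d) simp_all
    ultimately show ?thesis
      by (simp only: funpow_Suc_right o_apply fdiff_const)
  qed
  then show False
    using linear_diff_operator_symbol(2)[OF D] by blast
qed

end

section \<open>Determinacy of the trigonometric moment problem\<close>

text \<open>
  On the circle \<open>Re z\<close> and \<open>Im z\<close> are combinations of \<open>z\<close> and \<open>z\<^sup>-\<^sup>1 = cnj z\<close>.
\<close>

lemma real_polynomial_function_laurent:
  fixes g :: "complex \<Rightarrow> real"
  assumes "real_polynomial_function g"
  shows "\<exists>p. \<forall>z\<in>sphere 0 1. complex_of_real (g z) = laurent_eval p z"
  using assms
proof induction
  case (linear f)
  interpret f: bounded_linear f by fact
  (* With this a, the real number f z equals 2 Re (a z) = a z + cnj a * cnj z. *)
  define a where "a = Complex (f 1 / 2) (- f \<i> / 2)"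
  show ?case
  proof (rule exI, rule ballI)
    fix z :: complex assume "z \<in> sphere 0 1"
    then have "z * cnj z = 1"
      by (simp add: complex_norm_square[symmetric])
    then have "cnj z = inverse z"
      by (rule inverse_unique[symmetric])
    then have inv: "z powi - 1 = cnj z"
      by (simp add: power_int_minus)
    have "f z = f (Re z *\<^sub>R 1 + Im z *\<^sub>R \<i>)"
      by (rule arg_cong[where f = f]) (simp add: complex_eq_iff)
    also have "\<dots> = Re z * f 1 + Im z * f \<i>"
      unfolding f.add f.scaleR by simp
    finally have fz: "f z = Re z * f 1 + Im z * f \<i>" .
    show "complex_of_real (f z)
        = laurent_eval (laurent_scale a (zpow 1) + laurent_scale (cnj a) (zpow (- 1))) z"
      unfolding laurent_eval_add laurent_eval_scale laurent_eval_zpow inv fz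
      by (simp add: complex_eq_iff a_def field_simps)
  qed
next
  case (const c)
  have "complex_of_real c = laurent_eval (laurent_scale (of_real c) (zpow 0)) z" for z
    unfolding laurent_eval_scale laurent_eval_zpow by simp
  then show ?case by blast
next
  case (add f g)
  then obtain p q where "\<forall>z\<in>sphere 0 1. complex_of_real (f z) = laurent_eval p z"
    "\<forall>z\<in>sphere 0 1. complex_of_real (g z) = laurent_eval q z" by blast
  then show ?case by (intro exI[of _ "p + q"]) simp
next
  case (mult f g)
  then obtain p q where "\<forall>z\<in>sphere 0 1. complex_of_real (f z) = laurent_eval p z"
    "\<forall>z\<in>sphere 0 1. complex_of_real (g z) = laurent_eval q z" by blast
  moreover have "z \<noteq> 0" if "z \<in> sphere 0 1" for z :: complex
    using that by auto
  ultimately show ?case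
    by (intro exI[of _ "p * q"]) (simp add: laurent_eval_mult)
qed

context circle_prob
begin

lemma integral_laurent_eval:
  "(LINT z|\<mu>. laurent_eval p z)
    = (\<Sum>k\<in>Poly_Mapping.keys p. Poly_Mapping.lookup p k * (LINT z|\<mu>. z powi k))"
proof -
  have "integrable \<mu> (\<lambda>z. z powi k)" for k
    by (intro continuous_on_circle_integrable continuous_intros) auto
  then show ?thesis
    unfolding laurent_eval_def by (subst Bochner_Integration.integral_sum) auto
qed

text \<open>
  The continuous functions \<open>max 0 (1 - n dist(z, C))\<close> decrease to the indicator of the closed set \<open>C\<close>.
\<close>

lemma tendsto_measure_closed:
  assumes "closed C" and "C \<noteq> {}"
  shows "(\<lambda>n. LINT z|\<mu>. max 0 (1 - real n * infdist z C)) \<longlonglongrightarrow> measure \<mu> (C \<inter> space \<mu>)"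
proof -
  have meas: "C \<inter> space \<mu> \<in> sets \<mu>"
    unfolding sets_eq circle_borel_def using \<open>closed C\<close>
    by (auto simp: sets_restrict_space space_eq)
  have "(\<lambda>n. LINT z|\<mu>. max 0 (1 - real n * infdist z C)) \<longlonglongrightarrow> (LINT z|\<mu>. indicator (C \<inter> space \<mu>) z)"
  proof (rule integral_dominated_convergence[where w = "\<lambda>_. 1"])
    show "(indicator (C \<inter> space \<mu>) :: complex \<Rightarrow> real) \<in> borel_measurable \<mu>"
      using meas by simp
    show "(\<lambda>z. max 0 (1 - real n * infdist z C)) \<in> borel_measurable \<mu>" for n
      by (intro continuous_on_circle_measurable continuous_intros)
    show "AE z in \<mu>. norm (max 0 (1 - real n * infdist z C)) \<le> 1" for n
      by (simp add: infdist_nonneg)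
    show "AE z in \<mu>. (\<lambda>n. max 0 (1 - real n * infdist z C)) \<longlonglongrightarrow> indicator (C \<inter> space \<mu>) z"
    proof (rule AE_I2)
      fix z assume z: "z \<in> space \<mu>"
      show "(\<lambda>n. max 0 (1 - real n * infdist z C)) \<longlonglongrightarrow> indicator (C \<inter> space \<mu>) z"
      proof (cases "z \<in> C")
        case True
        then show ?thesis using z by simp
      next
        case False
        then have pos: "infdist z C > 0"
          using in_closed_iff_infdist_zero[OF assms] infdist_nonneg[of z C] by (simp add: less_le)
        obtain N :: nat where N: "1 / infdist z C < real N"
          using reals_Archimedean2 by blast
        have "max 0 (1 - real n * infdist z C) = 0" if "n \<ge> N" for n
        proof -
          have "1 / infdist z C \<le> real n" using N that by linarith
          then show ?thesis using pos by (simp add: divide_le_eq)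
        qed
        then have "\<forall>\<^sub>F n in sequentially. max 0 (1 - real n * infdist z C) = 0"
          by (rule eventually_sequentiallyI)
        then show ?thesis using False by (simp add: tendsto_eventually)
      qed
    qed
  qed simp
  then show ?thesis using meas by simp
qed

end

text \<open>
  Equal moments give equal integrals of Laurent polynomials, hence by Stone--Weierstrass of continuous
  functions, hence equal masses of closed sets; these form a generator of the Borel sets that is stable
  under intersection.
\<close>

theorem circle_prob_eqI:
  assumes "circle_prob \<mu>" and "circle_prob \<nu>"
    and moments: "\<And>s. (LINT z|\<mu>. z powi s) = (LINT z|\<nu>. z powi s)"
  shows "\<mu> = \<nu>"
proof -
  interpret M: circle_prob \<mu> by fact
  interpret N: circle_prob \<nu> by fact
  have cont: "(LINT z|\<mu>. f z) = (LINT z|\<nu>. f z)"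
    if f: "continuous_on (sphere 0 1) f" for f :: "complex \<Rightarrow> real"
  proof (rule ccontr)
    define d where "d = \<bar>(LINT z|\<mu>. f z) - (LINT z|\<nu>. f z)\<bar>"
    assume "(LINT z|\<mu>. f z) \<noteq> (LINT z|\<nu>. f z)"
    then have "d > 0" by (simp add: d_def)
    obtain g where g: "real_polynomial_function g"
      and fg: "\<And>z. z \<in> sphere 0 1 \<Longrightarrow> \<bar>f z - g z\<bar> < d / 3"
      by (rule Stone_Weierstrass_real_polynomial_function[OF compact_sphere f, of "d / 3"])
        (use \<open>d > 0\<close> in auto)
    have gc: "continuous_on (sphere 0 1) g"
      using g continuous_on_polymonial_function real_polynomial_function_eq by blast
    obtain p where p: "\<And>z. z \<in> sphere 0 1 \<Longrightarrow> complex_of_real (g z) = laurent_eval p z"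
      using real_polynomial_function_laurent[OF g] by blast
    have "complex_of_real (LINT z|\<mu>. g z) = (LINT z|\<mu>. laurent_eval p z)"
      unfolding integral_complex_of_real[symmetric]
      by (intro Bochner_Integration.integral_cong) (simp_all add: M.space_eq p)
    also have "\<dots> = (LINT z|\<nu>. laurent_eval p z)"
      by (simp add: M.integral_laurent_eval N.integral_laurent_eval moments)
    also have "\<dots> = complex_of_real (LINT z|\<nu>. g z)"
      unfolding integral_complex_of_real[symmetric]
      by (intro Bochner_Integration.integral_cong) (simp_all add: N.space_eq p)
    finally have g_eq: "(LINT z|\<mu>. g z) = (LINT z|\<nu>. g z)" by simp
    have close: "\<bar>(LINT z|\<rho>. f z) - (LINT z|\<rho>. g z)\<bar> \<le> d / 3" if "circle_prob \<rho>" for \<rho>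
    proof -
      interpret R: circle_prob \<rho> by fact
      have fi: "integrable \<rho> f" and gi: "integrable \<rho> g"
        using f gc by (simp_all add: R.continuous_on_circle_integrable)
      have "\<bar>(LINT z|\<rho>. f z) - (LINT z|\<rho>. g z)\<bar> = \<bar>LINT z|\<rho>. f z - g z\<bar>"
        using fi gi by simp
      also have "\<dots> \<le> (LINT z|\<rho>. \<bar>f z - g z\<bar>)"
        by (rule integral_abs_bound)
      also have "\<dots> \<le> (LINT z|\<rho>. d / 3)"
        using fi gi fg by (intro integral_mono) (auto simp: R.space_eq less_imp_le)
      finally show ?thesis by (simp add: R.prob_space)
    qed
    show False
    proof -
      have "d \<le> \<bar>(LINT z|\<mu>. f z) - (LINT z|\<mu>. g z)\<bar> + \<bar>(LINT z|\<nu>. f z) - (LINT z|\<nu>. g z)\<bar>"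
        unfolding d_def g_eq by linarith
      then show False
        using close[OF assms(1)] close[OF assms(2)] \<open>d > 0\<close> by linarith
    qed
  qed
  have closed_eq: "measure \<mu> (C \<inter> sphere 0 1) = measure \<nu> (C \<inter> sphere 0 1)" if "closed C" for C
  proof (cases "C = {}")
    case False
    have "(LINT z|\<mu>. max 0 (1 - real n * infdist z C)) = (LINT z|\<nu>. max 0 (1 - real n * infdist z C))" for n
      by (intro cont continuous_intros)
    then show ?thesis
      using M.tendsto_measure_closed[OF that False] N.tendsto_measure_closed[OF that False]
      by (simp add: LIMSEQ_unique M.space_eq N.space_eq)
  qed simp
  have id: "(\<lambda>z. z) \<in> measurable \<rho> borel" if "circle_prob \<rho>" for \<rho>
    by (intro circle_prob.continuous_on_circle_measurable[OF that] continuous_intros)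
  (* Pushing both measures to the whole plane allows the closed sets of the plane as the generator. *)
  have "distr \<mu> borel (\<lambda>z. z) = distr \<nu> borel (\<lambda>z. z)"
  proof (rule measure_eqI_generator_eq[where E = "Collect closed" and \<Omega> = UNIV and A = "\<lambda>_. UNIV"])
    show "Int_stable (Collect closed)"
      by (auto simp: Int_stable_def)
    show "emeasure (distr \<mu> borel (\<lambda>z. z)) X = emeasure (distr \<nu> borel (\<lambda>z. z)) X"
      if "X \<in> Collect closed" for X
      using that id[OF assms(1)] id[OF assms(2)]
      by (simp add: emeasure_distr M.space_eq N.space_eq M.emeasure_eq_measure N.emeasure_eq_measure closed_eq)
    show "emeasure (distr \<mu> borel (\<lambda>z. z)) UNIV \<noteq> \<infinity>"
      using id[OF assms(1)] by (simp add: emeasure_distr)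
  qed (simp_all add: borel_eq_closed)
  moreover have "emeasure \<rho> A = emeasure (distr \<rho> borel (\<lambda>z. z)) A"
    if "circle_prob \<rho>" "A \<in> sets circle_borel" for \<rho> A
  proof -
    interpret R: circle_prob \<rho> by fact
    have "A \<in> sets borel" "A \<subseteq> sphere 0 1"
      using that(2) by (auto simp: circle_borel_def sets_restrict_space)
    then show ?thesis
      using id[OF that(1)] by (simp add: emeasure_distr R.space_eq Int_absorb2)
  qed
  ultimately show ?thesis
    using assms by (intro measure_eqI) (auto simp: M.sets_eq N.sets_eq)
qed

section \<open>Lebesgue measure\<close>

lemma measurable_cis: "cis \<in> measurable borel circle_borel"
  unfolding circle_borel_def
  by (intro measurable_restrict_space2 borel_measurable_continuous_onI continuous_intros) auto

interpretation circle_lebesgue: circle_prob circle_lebesgue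
proof -
  interpret U: prob_space "uniform_measure lborel {0..<2 * pi}"
    by (rule prob_space_uniform_measure) simp_all
  have "cis \<in> measurable (uniform_measure lborel {0..<2 * pi}) circle_borel"
    using measurable_cis by (simp add: measurable_def)
  then show "circle_prob circle_lebesgue"
    unfolding circle_lebesgue_def circle_prob_def circle_prob_axioms_def
    by (simp add: U.prob_space_distr)
qed

lemma circle_lebesgue_moment:
  assumes "s \<noteq> 0"
  shows "(LINT z|circle_lebesgue. z powi s) = 0"
proof -
  define c where "c = \<i> * of_int s"
  have c: "c \<noteq> 0" using assms by (simp add: c_def)
  have cis_pow: "cis t powi s = exp (c * of_real t)" for t
    by (simp add: c_def cis_conv_exp exp_power_int mult_ac)
  let ?U = "uniform_measure lborel {0..<2 * pi}"
  have U: "?U = density lborel (\<lambda>t. ennreal (indicator {0..<2 * pi} t / (2 * pi)))"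
    unfolding uniform_measure_def
    by (intro density_cong) (auto simp: indicator_def divide_ennreal simp flip: ennreal_1)
  have mcis: "cis \<in> measurable ?U circle_borel"
    using measurable_cis by (simp add: measurable_def)
  have "(\<lambda>z. z powi s) \<in> borel_measurable circle_borel"
    unfolding circle_borel_def
    by (intro borel_measurable_continuous_on_restrict continuous_intros) auto
  then have "(LINT z|circle_lebesgue. z powi s) = (LINT t|?U. exp (c * of_real t))"
    unfolding circle_lebesgue_def by (subst integral_distr[OF mcis]) (simp_all add: cis_pow)
  also have "\<dots> = (LINT t|lborel. (indicator {0..<2 * pi} t / (2 * pi)) *\<^sub>R exp (c * of_real t))"
    unfolding U by (rule integral_density) (auto intro!: borel_measurable_continuous_onI continuous_intros)
  also have "\<dots> = (LINT t|lborel. (1 / (2 * pi)) *\<^sub>R (indicator {0..2 * pi} t *\<^sub>R exp (c * of_real t)))"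
  proof (rule integral_cong_AE)
    show "AE t in lborel. (indicator {0..<2 * pi} t / (2 * pi)) *\<^sub>R exp (c * of_real t)
        = (1 / (2 * pi)) *\<^sub>R (indicator {0..2 * pi} t *\<^sub>R exp (c * of_real t))"
      using AE_lborel_singleton[of "2 * pi"] by eventually_elim (auto simp: indicator_def)
  qed measurable
  also have "\<dots> = (1 / (2 * pi)) *\<^sub>R (exp (c * of_real (2 * pi)) / c - exp (c * of_real 0) / c)"
  proof -
    have "(LINT t|lborel. indicator {0..2 * pi} t *\<^sub>R exp (c * of_real t))
        = exp (c * of_real (2 * pi)) / c - exp (c * of_real 0) / c"
    proof (rule integral_FTC_atLeastAtMost)
      fix t :: real
      have "((\<lambda>z. exp (c * z) / c) has_field_derivative exp (c * of_real t)) (at (of_real t))"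
        using c by (auto intro!: derivative_eq_intros)
      then show "((\<lambda>t. exp (c * of_real t) / c) has_vector_derivative exp (c * of_real t))
          (at t within {0..2 * pi})"
        by (rule has_vector_derivative_real_field)
    qed (auto intro!: continuous_intros)
    then show ?thesis by (simp only: integral_scaleR_right)
  qed
  also have "exp (c * of_real (2 * pi)) = 1"
  proof -
    have "c * of_real (2 * pi) = of_int (2 * s) * of_real pi * \<i>"
      by (simp add: c_def mult_ac)
    then show ?thesis unfolding exp_eq_1 by (auto simp: c_def)
  qed
  finally show ?thesis by simp
qed

section \<open>The characterization\<close>

text \<open>
  The monomials are already orthonormal, so Gram--Schmidt leaves them unchanged.
\<close>

lemma olp_circle_lebesgue: "olp circle_lebesgue n = laurent_basis n"
proof (induction n rule: less_induct)
  case (less n)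
  have orth: "laurent_inner circle_lebesgue (laurent_basis n) (olp circle_lebesgue k) = 0"
    if "k < n" for k
  proof -
    have "olp_exponent n \<noteq> olp_exponent k"
      using that inj_olp_exponent by (auto dest: injD)
    then show ?thesis
      unfolding less[OF that] laurent_basis_eq circle_lebesgue.inner_zpow
      by (intro circle_lebesgue_moment) simp
  qed
  have "laurent_norm circle_lebesgue (laurent_basis n) = 1"
  proof -
    have "(LINT z|circle_lebesgue. (cmod (laurent_eval (laurent_basis n) z))\<^sup>2)
        = (LINT z|circle_lebesgue. 1)"
      by (rule Bochner_Integration.integral_cong)
        (auto simp: laurent_basis_eq circle_lebesgue.space_eq norm_power_int)
    then show ?thesis
      by (simp add: laurent_norm_def circle_lebesgue.prob_space)
  qed
  then show ?case
    by (subst olp.simps) (simp add: orth Let_def)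
qed

theorem theorem6p5:
  fixes \<mu> :: "complex measure"
  assumes "prob_space \<mu>"
    and "sets \<mu> = sets circle_borel"
    and "infinite (measure_support \<mu>)"
  shows "(\<exists>r\<ge>1. \<exists>D. linear_diff_operator r D \<and>
            (\<exists>n0\<ge>1. \<forall>n\<ge>n0.
               D (olp \<mu> n) \<in> laurent.span {olp \<mu> (n - 1), olp \<mu> n, olp \<mu> (n + 1)}))
         \<longleftrightarrow> \<mu> = circle_lebesgue"
proof
  assume "\<exists>r\<ge>1. \<exists>D. linear_diff_operator r D \<and>
            (\<exists>n0\<ge>1. \<forall>n\<ge>n0.
               D (olp \<mu> n) \<in> laurent.span {olp \<mu> (n - 1), olp \<mu> n, olp \<mu> (n + 1)})"
  then obtain r D n0 where r: "r \<ge> 1" and D: "linear_diff_operator r D"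
    and tri: "\<And>n. n \<ge> n0 \<Longrightarrow>
      D (olp \<mu> n) \<in> laurent.span {olp \<mu> (n - 1), olp \<mu> n, olp \<mu> (n + 1)}"
    by blast
  interpret prob_space \<mu> by fact
  interpret olp_tridiagonal \<mu> D n0
    by unfold_locales (use assms tri linear_diff_operator_linear[OF D] in auto)
  show "\<mu> = circle_lebesgue"
  proof (rule circle_prob_eqI)
    show "circle_prob \<mu>" "circle_prob circle_lebesgue"
      by unfold_locales
    show "(LINT z|\<mu>. z powi s) = (LINT z|circle_lebesgue. z powi s)" for s
    proof (cases "s = 0")
      case True
      then show ?thesis by (simp add: prob_space circle_lebesgue.prob_space)
    next
      case False
      then show ?thesis by (simp add: moment_eq_zero[OF D r] circle_lebesgue_moment)
    qed
  qed
next
  assume \<mu>: "\<mu> = circle_lebesgue"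
  define D where "D p = zpow 1 * laurent_deriv p" for p
  have "linear_diff_operator 1 D"
    unfolding linear_diff_operator_def
    by (rule exI[of _ "\<lambda>k. if k = 0 then 0 else zpow 1"]) (auto simp: D_def zpow_nonzero)
  moreover have "D (olp \<mu> n) \<in> laurent.span {olp \<mu> (n - 1), olp \<mu> n, olp \<mu> (n + 1)}" for n
  proof -
    have "D (olp \<mu> n) = laurent_scale (of_int (olp_exponent n)) (olp \<mu> n)"
      unfolding \<mu> olp_circle_lebesgue laurent_basis_eq D_def
      by (rule poly_mapping_eqI) (auto simp: lookup_single_mult lookup_laurent_deriv lookup_single when_def)
    then show ?thesis
      by (auto intro: laurent.span_scale laurent.span_base)
  qed
  ultimately show "\<exists>r\<ge>1. \<exists>D. linear_diff_operator r D \<and>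
            (\<exists>n0\<ge>1. \<forall>n\<ge>n0.
               D (olp \<mu> n) \<in> laurent.span {olp \<mu> (n - 1), olp \<mu> n, olp \<mu> (n + 1)})"
    by blast
qed

end
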